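(* Let $q\ge0$, $t\ge1$, $k\ge1$ be integers. A configuration $C=[c_1,\dots,c_k]$ of the dollar game on $W_k(q,t)$ is critical if and only if the cyclic sequence $c_1,\dots,c_k$ is a circular concatenation of blocks (cyclically consecutive entries) each of one of the forms $$B,M_1,\dots,M_j\qquad\text{or}\qquad B,M_1,\dots,M_j,0\qquad\text{or}\qquad B,M_1,\dots,M_j,0,q,q,\dots,q,$$ where $j\ge0$, $B\in\{1+q,\dots,q+t\}$ and each $M_i\in\{1,\dots,q\}$ (the values of $B$, the $M_i$, $j$ and the number of trailing $q$'s may differ from block to block).
   Context: $W_k(q,t)$ is the directed multigraph with hub $v_0$ and rim vertices $v_1,\dots,v_k$ in clockwise order (indices mod $k$), with $t$ edges each way between $v_0$ and each $v_i$, one edge $v_i\to v_{i-1}$ and $q$ edges $v_i\to v_{i+1}$. Dollar game: a configuration is a vector $C=[c_1,\dots,c_k]$ of nonnegative integers; the bank $v_0$ holds $c_0=-(c_1+\dots+c_k)$. A rim vertex $v_i$ may fire if $c_i\ge 1+q+t$; firing decreases $c_i$ by $1+q+t$, increases $c_{i+1}$ by $q$, $c_{i-1}$ by $1$ (indices mod $k$) and $c_0$ by $t$. The bank may fire only when no rim vertex can fire; firing it adds $t$ to every $c_i$ and subtracts $kt$ from $c_0$. A configuration is stable if no rim vertex can fire, recurrent if some nonempty legal sequence of firings leads from it back to itself, and critical if it is both stable and recurrent. *)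

theory Defs
  imports Main
begin

text \<open>
  \<open>wheel_edges k q t u v\<close> is the number of edges from \<open>v\<^sub>u\<close> to \<open>v\<^sub>v\<close> in \<open>W\<^sub>k(q,t)\<close>, for
  \<open>u, v \<le> k\<close>, with hub \<open>0\<close> and rim \<open>1, \<dots>, k\<close>. The two rim contributions add up when the clockwise
  and counterclockwise neighbours coincide: for \<open>k = 2\<close> there are \<open>q + 1\<close> parallel edges each way,
  for \<open>k = 1\<close> there are \<open>q + 1\<close> loops at \<open>v\<^sub>1\<close>.
\<close>

definition wheel_edges :: "nat \<Rightarrow> nat \<Rightarrow> nat \<Rightarrow> nat \<Rightarrow> nat \<Rightarrow> nat" where
  "wheel_edges k q t u v =
     (if u = 0 \<and> v = 0 then 0
      else if u = 0 \<or> v = 0 then t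
      else (if v mod k = (u + 1) mod k then q else 0) + (if (v + 1) mod k = u mod k then 1 else 0))"

text \<open>
  A configuration \<open>[c\<^sub>1, \<dots>, c\<^sub>k]\<close> is a list of length \<open>k\<close>, so that \<open>c ! i\<close> is the holding of
  \<open>v\<^bsub>i+1\<^esub>\<close> and \<open>k\<close> is recovered as \<open>length c\<close>. The holding of the bank is a function of the
  configuration and is not stored.
\<close>

definition bank_holding :: "nat list \<Rightarrow> int" where
  "bank_holding c = - int (sum_list c)"

definition can_fire :: "nat \<Rightarrow> nat \<Rightarrow> nat list \<Rightarrow> nat \<Rightarrow> bool" where
  "can_fire q t c i \<longleftrightarrow> i < length c \<and> 1 + q + t \<le> c ! i"

definition stable :: "nat \<Rightarrow> nat \<Rightarrow> nat list \<Rightarrow> bool" where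
  "stable q t c \<longleftrightarrow> (\<forall>i < length c. \<not> can_fire q t c i)"

text \<open>
  Only used under \<^const>\<open>can_fire\<close>, where the subtraction is exact. The condition
  \<open>(j + 1) mod length c = i\<close> says that \<open>j\<close> is the cyclic predecessor of \<open>i\<close>.
\<close>

definition fire_rim :: "nat \<Rightarrow> nat \<Rightarrow> nat \<Rightarrow> nat list \<Rightarrow> nat list" where
  "fire_rim q t i c =
     map (\<lambda>j. c ! j - (if j = i then 1 + q + t else 0)
                + (if j = (i + 1) mod length c then q else 0)
                + (if (j + 1) mod length c = i then 1 else 0))
         [0..<length c]"

definition fire_bank :: "nat \<Rightarrow> nat list \<Rightarrow> nat list" where
  "fire_bank t c = map (\<lambda>x. x + t) c"

inductive legal_firing :: "nat \<Rightarrow> nat \<Rightarrow> nat list \<Rightarrow> nat list \<Rightarrow> bool" for q t :: nat where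
  rim: "can_fire q t c i \<Longrightarrow> legal_firing q t c (fire_rim q t i c)"
| bank: "stable q t c \<Longrightarrow> legal_firing q t c (fire_bank t c)"

definition recurrent :: "nat \<Rightarrow> nat \<Rightarrow> nat list \<Rightarrow> bool" where
  "recurrent q t c \<longleftrightarrow> (legal_firing q t)\<^sup>+\<^sup>+ c c"

definition critical :: "nat \<Rightarrow> nat \<Rightarrow> nat list \<Rightarrow> bool" where
  "critical q t c \<longleftrightarrow> stable q t c \<and> recurrent q t c"

definition is_block :: "nat \<Rightarrow> nat \<Rightarrow> nat list \<Rightarrow> bool" where
  "is_block q t b \<longleftrightarrow>
     (\<exists>B Ms. B \<in> {1 + q..q + t} \<and> set Ms \<subseteq> {1..q} \<and>
        (b = B # Ms \<or>
         b = B # Ms @ [0] \<or>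
         (\<exists>n \<ge> 1. b = B # Ms @ [0] @ replicate n q)))"

text \<open>The rotation allows a block to run across the end of the list, from \<open>c\<^sub>k\<close> to \<open>c\<^sub>1\<close>.\<close>

definition circular_concat_of :: "('a list \<Rightarrow> bool) \<Rightarrow> 'a list \<Rightarrow> bool" where
  "circular_concat_of P c \<longleftrightarrow>
     (\<exists>r bs. rotate r c = concat bs \<and> (\<forall>b \<in> set bs. P b))"


text \<open>Firing moves one dollar along each edge of \<open>W\<^sub>k(q,t)\<close> that leaves the fired vertex.\<close>

lemma length_fire_rim [simp]: "length (fire_rim q t i c) = length c"
  by (simp add: fire_rim_def)

lemma length_fire_bank [simp]: "length (fire_bank t c) = length c"
  by (simp add: fire_bank_def)

lemma succ_mod_eq_iff:
  fixes i j k :: nat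
  assumes "i < k" "j < k"
  shows "(j + 1) mod k = i \<longleftrightarrow> j = (i + (k - 1)) mod k"
proof -
  have "(j + 1) mod k = (if j + 1 = k then 0 else j + 1)" using assms by auto
  moreover have "(i + (k - 1)) mod k = (if i = 0 then k - 1 else i - 1)"
    using assms by (auto simp: mod_if)
  ultimately show ?thesis using assms by auto
qed

lemma mod_Suc_eq_iff:
  fixes a b k :: nat
  shows "Suc a mod k = Suc b mod k \<longleftrightarrow> a mod k = b mod k"
  by (metis Suc_eq_plus1 mod_Suc nat.inject mod_Suc_eq zero_neq_one nat.distinct(1))

lemma wheel_edges_rim:
  assumes "i < k" "j < k"
  shows "wheel_edges k q t (Suc i) (Suc j) =
    (if j = (i + 1) mod k then q else 0) + (if (j + 1) mod k = i then 1 else 0)"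
  using assms by (simp add: wheel_edges_def mod_Suc_eq_iff)

lemma outdegree_rim:
  assumes "i < k"
  shows "(\<Sum>v\<le>k. wheel_edges k q t (Suc i) v) = 1 + q + t"
proof -
  have k: "0 < k" using assms by simp
  have "(\<Sum>v\<le>k. wheel_edges k q t (Suc i) v) =
      t + (\<Sum>j<k. wheel_edges k q t (Suc i) (Suc j))"
    by (subst sum.atMost_shift) (simp add: wheel_edges_def)
  also have "(\<Sum>j<k. wheel_edges k q t (Suc i) (Suc j)) =
      (\<Sum>j<k. (if j = (i + 1) mod k then q else 0) + (if j = (i + (k - 1)) mod k then 1 else 0))"
    using assms by (intro sum.cong) (simp_all only: wheel_edges_rim succ_mod_eq_iff lessThan_iff)
  also have "\<dots> = q + 1" using k by (simp add: sum.distrib)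
  finally show ?thesis by simp
qed

lemma outdegree_hub: "(\<Sum>v\<le>k. wheel_edges k q t 0 v) = k * t"
  by (subst sum.atMost_shift) (simp add: wheel_edges_def)

lemma fire_rim_edges:
  assumes "can_fire q t c i" "j < length c"
  shows "int (fire_rim q t i c ! j) =
    int (c ! j) - (if j = i then \<Sum>v\<le>length c. int (wheel_edges (length c) q t (Suc i) v) else 0)
      + int (wheel_edges (length c) q t (Suc i) (Suc j))"
proof -
  have i: "i < length c" and le: "1 + q + t \<le> c ! i" using assms(1) by (auto simp: can_fire_def)
  have out: "(\<Sum>v\<le>length c. int (wheel_edges (length c) q t (Suc i) v)) = int (1 + q + t)"
    using outdegree_rim[OF i, of q t] by (metis of_nat_sum)
  show ?thesis
    unfolding out using le i assms(2)
    by (simp only: wheel_edges_rim) (auto simp: fire_rim_def of_nat_diff)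
qed

lemma fire_bank_edges:
  assumes "j < length c"
  shows "fire_bank t c ! j = c ! j + wheel_edges (length c) q t 0 (Suc j)"
  using assms by (simp add: fire_bank_def wheel_edges_def)

lemma bank_holding_fire_rim:
  assumes "can_fire q t c i"
  shows "bank_holding (fire_rim q t i c) = bank_holding c + int t"
proof -
  let ?k = "length c"
  have i: "i < ?k" using assms by (auto simp: can_fire_def)
  have out: "(\<Sum>v\<le>?k. int (wheel_edges ?k q t (Suc i) v)) = int (1 + q + t)"
    using outdegree_rim[OF i, of q t] by (metis of_nat_sum)
  have split: "(\<Sum>v\<le>?k. int (wheel_edges ?k q t (Suc i) v)) =
      int t + (\<Sum>j<?k. int (wheel_edges ?k q t (Suc i) (Suc j)))"
    by (subst sum.atMost_shift) (simp add: wheel_edges_def)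
  have sl: "int (sum_list d) = (\<Sum>j<length d. int (d ! j))" for d :: "nat list"
    by (simp add: sum_list_sum_nth atLeast0LessThan)
  have "int (sum_list (fire_rim q t i c)) =
      (\<Sum>j<?k. int (c ! j) - (if j = i then int (1 + q + t) else 0)
        + int (wheel_edges ?k q t (Suc i) (Suc j)))"
    unfolding sl length_fire_rim
    by (rule sum.cong[OF refl]) (simp only: fire_rim_edges[OF assms] out lessThan_iff)
  also have "\<dots> = int (sum_list c) - int (1 + q + t)
      + (\<Sum>j<?k. int (wheel_edges ?k q t (Suc i) (Suc j)))"
    using i by (simp add: sum.distrib sum_subtractf sl)
  also have "\<dots> = int (sum_list c) - int t" using split out by simp
  finally show ?thesis by (simp add: bank_holding_def)
qed

lemma bank_holding_fire_bank:
  "bank_holding (fire_bank t c) = bank_holding c - int (length c * t)"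
  by (simp add: bank_holding_def fire_bank_def sum_list_addf sum_list_triv)

end

theory Submission
  imports Defs
begin

text \<open>
  This is Dhar's burning algorithm. Start a round by firing the bank from a stable configuration.
  Until the bank fires again every rim vertex can fire at most once, and if \<open>n\<close> of the \<open>k\<close> of them
  do, the total holding of the rim grows by \<open>(k - n) t\<close>. On a closed firing sequence there is no
  growth, so every round is full, and a full round restores the configuration. Hence a stable
  configuration is critical iff no nonempty set of rim vertices blocks itself in the round.
  A vertex with more than \<open>q\<close> dollars never blocks; one with \<open>1, \<dots>, q\<close> dollars fires after its
  predecessor, one with exactly \<open>q\<close> also after its successor, and for \<open>q > 0\<close> one with \<open>0\<close> only
  after both. Hence there must be a vertex with more than \<open>q\<close> dollars, and then a self-blocking set
  exists iff there is an arc through values at most \<open>q\<close> from a \<open>0\<close> to a value below \<open>q\<close>. These are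
  exactly the arcs that a circular concatenation of blocks avoids.
\<close>

section \<open>Self-blocking sets\<close>

definition cpred :: "nat \<Rightarrow> nat \<Rightarrow> nat" where
  "cpred k j = (j + (k - 1)) mod k"

definition csucc :: "nat \<Rightarrow> nat \<Rightarrow> nat" where
  "csucc k j = (j + 1) mod k"

text \<open>Even if everything outside \<open>T\<close> has fired after the bank, no vertex of \<open>T\<close> can fire.\<close>

definition blocked :: "nat \<Rightarrow> nat list \<Rightarrow> nat set \<Rightarrow> bool" where
  "blocked q c T \<longleftrightarrow> T \<subseteq> {..<length c} \<and>
     (\<forall>j\<in>T. c ! j + (if cpred (length c) j \<in> T then 0 else q)
        + (if csucc (length c) j \<in> T then 0 else 1) \<le> q)"

text \<open>\<open>d\<close> arises from \<open>b\<close> by firing the bank and then every vertex of \<open>S\<close> once; the equations are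
  arranged so that no subtraction occurs.\<close>

definition round_state :: "nat \<Rightarrow> nat \<Rightarrow> nat list \<Rightarrow> nat set \<Rightarrow> nat list \<Rightarrow> bool" where
  "round_state q t b S d \<longleftrightarrow> length d = length b \<and> S \<subseteq> {..<length b} \<and>
     (\<forall>j<length b. d ! j + (if j \<in> S then 1 + q + t else 0) =
        b ! j + t + (if cpred (length b) j \<in> S then q else 0)
          + (if csucc (length b) j \<in> S then 1 else 0)) \<and>
     sum_list d + card S * t = sum_list b + length b * t"

lemma round_stateD:
  assumes "round_state q t b S d" "j < length b"
  shows "d ! j + (if j \<in> S then 1 + q + t else 0) =
    b ! j + t + (if cpred (length b) j \<in> S then q else 0)
      + (if csucc (length b) j \<in> S then 1 else 0)"
  using assms unfolding round_state_def by blast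

lemma cpred_less: "j < k \<Longrightarrow> cpred k j < k" and csucc_less: "j < k \<Longrightarrow> csucc k j < k"
  by (simp_all add: cpred_def csucc_def)

lemma cpred_eq_iff: "i < k \<Longrightarrow> j < k \<Longrightarrow> cpred k j = i \<longleftrightarrow> j = (i + 1) mod k"
  unfolding cpred_def using succ_mod_eq_iff[of j k i] by metis

lemma stable_iff_bounded: "stable q t c \<longleftrightarrow> (\<forall>x\<in>set c. x \<le> q + t)"
  by (auto simp: stable_def can_fire_def all_set_conv_all_nth)

section \<open>Invariant of a round\<close>

lemma round_state_fire_bank: "round_state q t b {} (fire_bank t b)"
  by (simp add: round_state_def fire_bank_def sum_list_addf sum_list_triv)

lemma sum_list_fire_rim:
  assumes "can_fire q t d i"
  shows "sum_list (fire_rim q t i d) + t = sum_list d"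
  using bank_holding_fire_rim[OF assms] by (simp add: bank_holding_def)

text \<open>Within a round a vertex receives at most \<open>t + q + 1\<close>, exactly the price of
  one firing, so after firing it is at or below its stable starting value.\<close>

lemma fired_cannot_fire:
  assumes "round_state q t b S d" "stable q t b" "can_fire q t d i"
  shows "i \<notin> S"
proof
  assume "i \<in> S"
  have i: "i < length b" and big: "1 + q + t \<le> d ! i"
    using assms by (auto simp: can_fire_def round_state_def)
  have "b ! i \<le> q + t" using assms(2) i by (auto simp: stable_iff_bounded)
  moreover have "d ! i + (1 + q + t) = b ! i + t + (if cpred (length b) i \<in> S then q else 0)
          + (if csucc (length b) i \<in> S then 1 else 0)"
    using round_stateD[OF assms(1) i] \<open>i \<in> S\<close> by simp
  ultimately show False using big by (simp split: if_splits)
qed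

lemma round_state_fire_rim:
  assumes rs: "round_state q t b S d" and fire: "can_fire q t d i" and new: "i \<notin> S"
  shows "round_state q t b (insert i S) (fire_rim q t i d)"
proof -
  let ?k = "length b"
  have len: "length d = ?k" and S: "S \<subseteq> {..<?k}" using rs by (auto simp: round_state_def)
  have i: "i < ?k" and big: "1 + q + t \<le> d ! i" using fire len by (auto simp: can_fire_def)
  have eq: "d ! j + (if j \<in> S then 1 + q + t else 0) =
        b ! j + t + (if cpred ?k j \<in> S then q else 0) + (if csucc ?k j \<in> S then 1 else 0)"
    if "j < ?k" for j using round_stateD[OF rs that] .
  have "fire_rim q t i d ! j + (if j \<in> insert i S then 1 + q + t else 0) =
        b ! j + t + (if cpred ?k j \<in> insert i S then q else 0)
          + (if csucc ?k j \<in> insert i S then 1 else 0)" if j: "j < ?k" for j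
  proof -
    have "fire_rim q t i d ! j = d ! j - (if j = i then 1 + q + t else 0)
        + (if cpred ?k j = i then q else 0) + (if csucc ?k j = i then 1 else 0)"
      using j len cpred_eq_iff[OF i j] by (simp add: fire_rim_def csucc_def)
    then show ?thesis using eq[OF j] new big by (auto split: if_splits)
  qed
  moreover have "sum_list (fire_rim q t i d) + card (insert i S) * t = sum_list b + ?k * t"
    using sum_list_fire_rim[OF fire] rs new finite_subset[OF S]
    by (simp add: round_state_def)
  ultimately show ?thesis using len S i by (simp add: round_state_def)
qed

text \<open>Each vertex pays \<open>1 + q + t\<close> and gets back \<open>t\<close> from the bank
  and \<open>q\<close> and 1 along the rim.\<close>

lemma round_state_full:
  assumes "round_state q t b {..<length b} d"
  shows "d = b"
proof (rule nth_equalityI)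
  fix j assume "j < length d"
  then have "j < length b" using assms by (simp add: round_state_def)
  then show "d ! j = b ! j"
    using round_stateD[OF assms, of j] by (simp add: cpred_less csucc_less)
qed (use assms in \<open>simp add: round_state_def\<close>)

section \<open>Recurrence and self-blocking sets\<close>

text \<open>Take a fired set \<open>S\<close> of largest size within one round. Its complement
  cannot fire, hence blocks itself, hence is empty; the full round has returned to
  \<open>c\<close>.\<close>

lemma recurrent_if_no_blocked:
  assumes st: "stable q t c" and nb: "\<And>T. blocked q c T \<Longrightarrow> T = {}"
  shows "recurrent q t c"
proof -
  let ?k = "length c"
  let ?R = "\<lambda>S. \<exists>d. (legal_firing q t)\<^sup>+\<^sup>+ c d \<and> round_state q t c S d"
  have R0: "?R {}" using st round_state_fire_bank legal_firing.bank by blast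
  have bound: "\<forall>S. ?R S \<longrightarrow> card S < Suc ?k"
  proof (intro allI impI)
    fix S assume "?R S"
    then have "S \<subseteq> {..<?k}" by (auto simp: round_state_def)
    from card_mono[OF _ this] show "card S < Suc ?k" by simp
  qed
  obtain S where S: "?R S" and max: "\<And>S'. ?R S' \<Longrightarrow> card S' \<le> card S"
    using Lattices_Big.ex_has_greatest_nat[of ?R, OF R0 bound] by blast
  from S obtain d where path: "(legal_firing q t)\<^sup>+\<^sup>+ c d" and rs: "round_state q t c S d"
    by blast
  have Sk: "S \<subseteq> {..<?k}" and len: "length d = ?k" using rs by (auto simp: round_state_def)
  have "blocked q c ({..<?k} - S)"
    unfolding blocked_def
  proof (intro conjI ballI)
    fix j assume j: "j \<in> {..<?k} - S"
    have "\<not> can_fire q t d j"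
    proof
      assume f: "can_fire q t d j"
      then have "?R (insert j S)"
        using round_state_fire_rim[OF rs f] j path legal_firing.rim[OF f]
        by (blast intro: tranclp.trancl_into_trancl)
      from max[OF this] show False using j finite_subset[OF Sk] by simp
    qed
    then have "d ! j \<le> q + t" using j len by (simp add: can_fire_def)
    moreover have "d ! j = c ! j + t + (if cpred ?k j \<in> S then q else 0)
        + (if csucc ?k j \<in> S then 1 else 0)"
      using round_stateD[OF rs, of j] j by simp
    ultimately show "c ! j + (if cpred ?k j \<in> {..<?k} - S then 0 else q)
        + (if csucc ?k j \<in> {..<?k} - S then 0 else 1) \<le> q"
      using j by (auto simp: cpred_less csucc_less)
  qed simp
  then have "S = {..<?k}" using nb Sk by blast
  then have "d = c" using rs round_state_full by blast
  then show ?thesis using path by (simp add: recurrent_def)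
qed

text \<open>Only neighbours outside \<open>T\<close> can have paid \<open>i\<close> so far, and
  \<open>blocked\<close> bounds \<open>c ! i\<close> plus such payments by \<open>q\<close>; the
  bank adds only \<open>t\<close>.\<close>

lemma blocked_cannot_fire:
  assumes "blocked q c T" "round_state q t c S d" "S \<inter> T = {}" "can_fire q t d i"
  shows "i \<notin> T"
proof
  assume i: "i \<in> T"
  have ik: "i < length c" and big: "1 + q + t \<le> d ! i"
    using assms by (auto simp: can_fire_def round_state_def)
  have "d ! i = c ! i + t + (if cpred (length c) i \<in> S then q else 0)
      + (if csucc (length c) i \<in> S then 1 else 0)"
  proof -
    have "i \<notin> S" using assms(3) i by blast
    then show ?thesis using round_stateD[OF assms(2) ik] by simp
  qed
  moreover have "c ! i + (if cpred (length c) i \<in> T then 0 else q)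
        + (if csucc (length c) i \<in> T then 0 else 1) \<le> q"
    using assms(1) i by (auto simp: blocked_def)
  ultimately show False using big assms(3) by (auto split: if_splits)
qed

text \<open>The total holding of the rim is a potential: \<open>T\<close> keeps the first round from
  being full, so that round has a strict gain, and no later round has a loss.\<close>

lemma not_recurrent_if_blocked:
  assumes t: "t \<ge> 1" and st: "stable q t c" and bl: "blocked q c T" and ne: "T \<noteq> {}"
  shows "\<not> recurrent q t c"
proof
  assume "recurrent q t c"
  then have "(legal_firing q t)\<^sup>+\<^sup>+ c c" by (simp add: recurrent_def)
  \<comment> \<open>Either the first round is still running, or a round has been completed with a gain.\<close>
  let ?I = "\<lambda>d. \<exists>b S. stable q t b \<and> length b = length c \<and> round_state q t b S d \<and>
      (b = c \<and> S \<inter> T = {} \<or> sum_list c < sum_list b)"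
  have le: "card S * t \<le> length b * t" if "round_state q t b S d" for b S d
    using that card_mono[of "{..<length b}" S] by (simp add: round_state_def)
  \<comment> \<open>\<open>S\<close> misses the nonempty \<open>T\<close>, so fewer than
    \<open>length c\<close> vertices have fired; \<open>t \<ge> 1\<close> makes this strict.\<close>
  have less: "card S * t < length c * t" if "round_state q t c S d" "S \<inter> T = {}" for S d
  proof -
    have "S \<subset> {..<length c}" using that bl ne by (auto simp: round_state_def blocked_def)
    from psubset_card_mono[OF _ this] show ?thesis using t by simp
  qed
  have gain: "sum_list c < sum_list d" if "?I d" for d
  proof -
    from that obtain b S where rs: "round_state q t b S d"
      and alt: "b = c \<and> S \<inter> T = {} \<or> sum_list c < sum_list b" by blast
    have "sum_list d + card S * t = sum_list b + length b * t"
      using rs by (simp add: round_state_def)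
    moreover have "card S * t \<le> length b * t" using le[OF rs] .
    moreover have "b = c \<and> S \<inter> T = {} \<Longrightarrow> card S * t < length b * t" using less rs by blast
    ultimately show ?thesis using alt
    proof (elim disjE)
      assume "b = c \<and> S \<inter> T = {}" "b = c \<and> S \<inter> T = {} \<Longrightarrow> card S * t < length b * t"
        and *: "sum_list d + card S * t = sum_list b + length b * t"
      then have "card S * t < length b * t" "b = c" by blast+
      with * show ?thesis by (metis add_less_cancel_right nat_add_left_cancel_less)
    qed linarith
  qed
  have start: "?I d" if step: "legal_firing q t c d" for d
    using step
  proof cases
    case (rim i)
    then show ?thesis using st by (auto simp: stable_def can_fire_def)
  next
    case bank
    then show ?thesis using st round_state_fire_bank by blast
  qed
  have step: "?I e" if I: "?I d" and de: "legal_firing q t d e" for d e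
  proof -
    from I obtain b S where b: "stable q t b" "length b = length c"
      and rs: "round_state q t b S d"
      and alt: "b = c \<and> S \<inter> T = {} \<or> sum_list c < sum_list b" by blast
    from de show ?thesis
    proof cases
      case (rim i)
      have rs': "round_state q t b (insert i S) e"
        using rim round_state_fire_rim[OF rs] fired_cannot_fire[OF rs b(1)] by blast
      have "b = c \<and> insert i S \<inter> T = {} \<or> sum_list c < sum_list b"
        using alt blocked_cannot_fire[OF bl _ _ rim(2)] rs by blast
      with b rs' show ?thesis by blast
    next
      \<comment> \<open>\<open>d\<close> becomes the base of a new round, and \<open>gain\<close>
        gives the second alternative.\<close>
      case bank
      have "length d = length c" using rs b by (simp add: round_state_def)
      then show ?thesis using bank gain[OF I] round_state_fire_bank by blast
    qed
  qed
  have "?I c"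
    using \<open>(legal_firing q t)\<^sup>+\<^sup>+ c c\<close> by (rule tranclp_induct) (erule start, rule step)
  from gain[OF this] show False by simp
qed

lemma critical_iff_no_blocked:
  assumes "t \<ge> 1"
  shows "critical q t c \<longleftrightarrow> (\<forall>x\<in>set c. x \<le> q + t) \<and> (\<forall>T. blocked q c T \<longrightarrow> T = {})"
  unfolding critical_def stable_iff_bounded[symmetric]
  using recurrent_if_no_blocked not_recurrent_if_blocked[OF assms] by metis

section \<open>Blocks\<close>

lemma blocked_rotate:
  assumes bl: "blocked q c T"
  shows "blocked q (rotate r c) {i. i < length c \<and> (r + i) mod length c \<in> T}"
    (is "blocked _ _ ?T")
  unfolding blocked_def length_rotate
proof (intro conjI ballI)
  let ?k = "length c"
  fix j assume j: "j \<in> ?T"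
  let ?i = "(r + j) mod ?k"
  have jk: "j < ?k" using j by simp
  have "(r + cpred ?k j) mod ?k = cpred ?k ?i" "(r + csucc ?k j) mod ?k = csucc ?k ?i"
    unfolding cpred_def csucc_def by (simp_all add: mod_simps add.assoc)
  moreover have "c ! ?i + (if cpred ?k ?i \<in> T then 0 else q)
      + (if csucc ?k ?i \<in> T then 0 else 1) \<le> q"
    using bl j by (simp add: blocked_def)
  ultimately show "rotate r c ! j + (if cpred ?k j \<in> ?T then 0 else q)
      + (if csucc ?k j \<in> ?T then 0 else 1) \<le> q"
    using jk by (simp add: nth_rotate cpred_less csucc_less)
qed auto

lemma no_blocked_rotate:
  assumes nb: "\<And>T. blocked q (rotate r c) T \<Longrightarrow> T = {}" and bl: "blocked q c T"
  shows "T = {}"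
proof (rule ccontr)
  assume "T \<noteq> {}"
  then obtain j where j: "j \<in> T" by blast
  let ?k = "length c"
  have jk: "j < ?k" using j bl by (auto simp: blocked_def)
  \<comment> \<open>The position of entry \<open>j\<close> after the rotation: \<open>j - r\<close>
    modulo \<open>?k\<close>, kept nonnegative.\<close>
  let ?i = "(j + (?k - r mod ?k)) mod ?k"
  have "(r + ?i) mod ?k = (r mod ?k + (j + (?k - r mod ?k))) mod ?k" by (simp add: mod_simps)
  also have "r mod ?k + (j + (?k - r mod ?k)) = j + ?k"
    using mod_less_divisor[of ?k r] jk by linarith
  also have "(j + ?k) mod ?k = j" using jk by simp
  finally have "(r + ?i) mod ?k \<in> T" using j by simp
  moreover have "?i < ?k" using jk by (intro mod_less_divisor) linarith
  ultimately have "?i \<in> {i. i < ?k \<and> (r + i) mod ?k \<in> T}" by blast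
  then show False using nb[OF blocked_rotate[OF bl]] by blast
qed

section \<open>Arcs from a 0 to a value below q\<close>

text \<open>The arc condition without wrap-around. It suffices for lists that start with a value
  above \<open>q\<close>, since no arc of values at most \<open>q\<close> then crosses the
  end.\<close>

definition gapfree :: "nat \<Rightarrow> nat list \<Rightarrow> bool" where
  "gapfree q c \<longleftrightarrow> (\<forall>i j. i < j \<longrightarrow> j < length c \<longrightarrow> c ! i = 0 \<longrightarrow> c ! j < q \<longrightarrow>
     (\<exists>m. i < m \<and> m < j \<and> q < c ! m))"

lemma gapfreeD:
  assumes "gapfree q c" "i < j" "j < length c" "c ! i = 0" "c ! j < q"
  obtains m where "i < m" "m < j" "q < c ! m"
  using assms unfolding gapfree_def by blast

text \<open>A violating arc \<open>{i..j}\<close> blocks itself: its first value 0 tolerates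
  \<open>q\<close> from outside, its last value, below \<open>q\<close>, tolerates 1, and inner
  vertices get nothing.\<close>

lemma gapfree_if_no_blocked:
  assumes nb: "\<And>T. blocked q c T \<Longrightarrow> T = {}"
  shows "gapfree q c"
  unfolding gapfree_def
proof (intro allI impI, rule ccontr)
  fix i j assume ij: "i < j" "j < length c" "c ! i = 0" "c ! j < q"
    and no: "\<nexists>m. i < m \<and> m < j \<and> q < c ! m"
  let ?k = "length c"
  have "blocked q c {i..j}"
    unfolding blocked_def
  proof (intro conjI ballI)
    fix m assume m: "m \<in> {i..j}"
    have p: "cpred ?k m \<in> {i..j}" if "i < m"
    proof -
      have "cpred ?k m = m - 1" using m that ij by (auto simp: cpred_def mod_if)
      then show ?thesis using m that by auto
    qed
    have s: "csucc ?k m \<in> {i..j}" if "m < j"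
      using m that ij by (auto simp: csucc_def)
    have "m = i \<or> m = j \<or> c ! m \<le> q" using no m by (metis atLeastAtMost_iff le_neq_implies_less not_le)
    then show "c ! m + (if cpred ?k m \<in> {i..j} then 0 else q)
        + (if csucc ?k m \<in> {i..j} then 0 else 1) \<le> q"
      using p s ij m by (cases "m = i"; cases "m = j") auto
  qed (use ij in auto)
  from nb[OF this] ij show False by simp
qed

text \<open>The first entry is too large to lie in \<open>T\<close>, so no arc of \<open>T\<close>
  wraps around. The leftmost arc starts at a 0, ends below \<open>q\<close> and has no separator
  inside.\<close>

lemma no_blocked_if_gapfree:
  assumes gf: "gapfree q c" and hd: "q < c ! 0" and bl: "blocked q c T"
  shows "T = {}"
proof (rule ccontr)
  assume ne: "T \<noteq> {}"
  let ?k = "length c"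
  have Tk: "T \<subseteq> {..<?k}" using bl by (simp add: blocked_def)
  then have fin: "finite T" by (rule finite_subset) simp
  have b: "c ! j + (if cpred ?k j \<in> T then 0 else q) + (if csucc ?k j \<in> T then 0 else 1) \<le> q"
    if "j \<in> T" for j using bl that by (simp add: blocked_def)
  have small: "c ! j \<le> q" if "j \<in> T" for j using b[OF that] by linarith
  have zero: "0 \<notin> T" using small hd by force
  have succ: "csucc ?k j = Suc j" if "csucc ?k j \<in> T" "j \<in> T" for j
    using that zero Tk by (cases "Suc j = ?k") (auto simp: csucc_def)
  define i where "i = Min T"
  have iT: "i \<in> T" and least: "\<And>m. m \<in> T \<Longrightarrow> i \<le> m" using fin ne by (auto simp: i_def)
  have ik: "i < ?k" and i0: "0 < i" using iT Tk zero by (auto intro: gr0I)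
  have "cpred ?k i = i - 1" using ik i0 by (auto simp: cpred_def mod_if)
  then have "cpred ?k i \<notin> T" using least[of "i - 1"] i0 by auto
  then have ci: "c ! i = 0" and "csucc ?k i \<in> T" using b[OF iT] by (auto split: if_splits)
  then have sT: "Suc i \<in> T" using succ iT by metis
  \<comment> \<open>\<open>n\<close> is the first position after the arc of \<open>T\<close> that starts at \<open>i\<close>.\<close>
  define n where "n = (LEAST n. i < n \<and> n \<notin> T)"
  have ex: "i < ?k \<and> ?k \<notin> T" using ik Tk by auto
  have n: "i < n" "n \<notin> T" using LeastI[of "\<lambda>n. i < n \<and> n \<notin> T", OF ex] by (auto simp: n_def)
  have arc: "m \<in> T" if "i \<le> m" "m < n" for m
    using not_less_Least[of m "\<lambda>n. i < n \<and> n \<notin> T"] that iT unfolding n_def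
    by (metis le_neq_implies_less)
  \<comment> \<open>The arc has at least two vertices, so \<open>gapfree\<close> applies to its
    ends.\<close>
  have ni: "Suc i < n" using n sT by (metis Suc_lessI)
  define j where "j = n - 1"
  have j: "i < j" "j < n" "Suc j = n" using ni by (auto simp: j_def)
  have jT: "j \<in> T" using arc j by simp
  then have "csucc ?k j \<notin> T" using succ[of j] n j by metis
  then have "c ! j < q" using b[OF jT] by (auto split: if_splits)
  moreover have "j < ?k" using jT Tk by auto
  ultimately obtain m where "i < m" "m < j" "q < c ! m" using gapfreeD[OF gf j(1)] ci by blast
  then show False using small[of m] arc[of m] j by simp
qed

text \<open>A pair straddling the junction is separated by \<open>hd ys\<close>.\<close>

lemma gapfree_append:
  assumes "gapfree q xs" "gapfree q ys" "ys \<noteq> [] \<Longrightarrow> q < hd ys"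
  shows "gapfree q (xs @ ys)"
  unfolding gapfree_def
proof (intro allI impI)
  fix i j assume ij: "i < j" "j < length (xs @ ys)" "(xs @ ys) ! i = 0" "(xs @ ys) ! j < q"
  let ?n = "length xs"
  consider "j < ?n" | "?n \<le> i" | "i < ?n" "?n \<le> j" by linarith
  then show "\<exists>m. i < m \<and> m < j \<and> q < (xs @ ys) ! m"
  proof cases
    case 1
    then obtain m where "i < m" "m < j" "q < xs ! m"
      using gapfreeD[OF assms(1) ij(1)] ij by (auto simp: nth_append)
    then show ?thesis using 1 by (auto simp: nth_append intro!: exI[of _ m])
  next
    case 2
    have "i - ?n < j - ?n" "j - ?n < length ys" "ys ! (i - ?n) = 0" "ys ! (j - ?n) < q"
      using 2 ij by (auto simp: nth_append)
    from gapfreeD[OF assms(2) this]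
    obtain m where "i - ?n < m" "m < j - ?n" "q < ys ! m" .
    then show ?thesis using 2 by (auto simp: nth_append intro!: exI[of _ "m + ?n"])
  next
    case 3
    have "ys \<noteq> []" using 3 ij by auto
    then have "q < (xs @ ys) ! ?n" using assms(3) by (simp add: nth_append hd_conv_nth)
    moreover have "j \<noteq> ?n" using calculation ij by auto
    ultimately show ?thesis using 3 by (auto intro!: exI[of _ ?n])
  qed
qed

lemma gapfree_appendD1:
  assumes "gapfree q (xs @ ys)"
  shows "gapfree q xs"
  unfolding gapfree_def
proof (intro allI impI)
  fix i j assume ij: "i < j" "j < length xs" "xs ! i = 0" "xs ! j < q"
  obtain m where "i < m" "m < j" "q < (xs @ ys) ! m"
    using gapfreeD[OF assms ij(1)] ij by (force simp: nth_append)
  then show "\<exists>m>i. m < j \<and> q < xs ! m" using ij by (auto simp: nth_append)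
qed

lemma gapfree_appendD2:
  assumes "gapfree q (xs @ ys)"
  shows "gapfree q ys"
  unfolding gapfree_def
proof (intro allI impI)
  fix i j assume ij: "i < j" "j < length ys" "ys ! i = 0" "ys ! j < q"
  let ?n = "length xs"
  obtain m where "?n + i < m" "m < ?n + j" "q < (xs @ ys) ! m"
    using gapfreeD[OF assms, of "?n + i" "?n + j"] ij by auto
  then show "\<exists>m>i. m < j \<and> q < ys ! m"
    by (intro exI[of _ "m - ?n"]) (auto simp: nth_append)
qed

section \<open>Decomposition into blocks\<close>

text \<open>The first two forms of a block are the cases \<open>zs = []\<close> and \<open>n = 0\<close>.\<close>

lemma is_block_iff:
  "is_block q t b \<longleftrightarrow> (\<exists>B Ms zs n. b = B # Ms @ zs \<and> B \<in> {1 + q..q + t} \<and> set Ms \<subseteq> {1..q} \<and>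
     (zs = [] \<or> zs = 0 # replicate n q))" (is "?L \<longleftrightarrow> ?R")
proof
  assume ?L
  then obtain B Ms where B: "B \<in> {1 + q..q + t}" "set Ms \<subseteq> {1..q}"
    and "b = B # Ms \<or> b = B # Ms @ [0] \<or> (\<exists>n \<ge> 1. b = B # Ms @ [0] @ replicate n q)"
    unfolding is_block_def by blast
  then consider "b = B # Ms @ []" | "b = B # Ms @ 0 # replicate 0 q"
    | n where "b = B # Ms @ 0 # replicate n q" by auto
  then show ?R using B by cases blast+
next
  assume ?R
  then obtain B Ms zs n where B: "B \<in> {1 + q..q + t}" "set Ms \<subseteq> {1..q}"
    and b: "b = B # Ms @ zs" "zs = [] \<or> zs = 0 # replicate n q" by blast
  then have "b = B # Ms \<or> b = B # Ms @ [0] \<or> (\<exists>n \<ge> 1. b = B # Ms @ [0] @ replicate n q)"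
    by (cases "n = 0") (auto intro: exI[of _ n])
  with B show ?L unfolding is_block_def by blast
qed

lemma is_block_hd: "is_block q t b \<Longrightarrow> b \<noteq> [] \<and> q < hd b"
  by (auto simp: is_block_iff)

lemma is_block_bounded: "is_block q t b \<Longrightarrow> x \<in> set b \<Longrightarrow> x \<le> q + t"
  by (force simp: is_block_iff)

text \<open>Zeros occur only in \<open>zs\<close>, where everything after the leading 0 equals
  \<open>q\<close>, so no pair satisfies the premises of \<open>gapfree\<close>.\<close>

lemma is_block_gapfree:
  assumes "is_block q t b"
  shows "gapfree q b"
proof -
  obtain B Ms zs n where b: "b = (B # Ms) @ zs" "B \<in> {1 + q..q + t}" "set Ms \<subseteq> {1..q}"
    "zs = [] \<or> zs = 0 # replicate n q" using assms by (auto simp: is_block_iff)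
  have pos: "0 < (B # Ms) ! i" if "i < length (B # Ms)" for i
    using that b(2,3) nth_mem[OF that] by auto
  show ?thesis
    unfolding gapfree_def
  proof (intro allI impI)
    fix i j assume ij: "i < j" "j < length b" "b ! i = 0" "b ! j < q"
    have "length (B # Ms) \<le> i"
      using pos[of i] ij unfolding b(1) by (metis nth_append not_le less_irrefl)
    then have "b ! j = zs ! (j - length (B # Ms))" "0 < j - length (B # Ms)"
      "j - length (B # Ms) < length zs"
      using ij unfolding b(1) by (auto simp: nth_append)
    then have "b ! j = q" using b(4) by (auto simp: nth_Cons')
    with ij show "\<exists>m>i. m < j \<and> q < b ! m" by simp
  qed
qed

lemma concat_blocks:
  assumes "\<forall>b\<in>set bs. is_block q t b"
  shows "gapfree q (concat bs) \<and> (\<forall>x\<in>set (concat bs). x \<le> q + t) \<and>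
    (concat bs \<noteq> [] \<longrightarrow> q < hd (concat bs))"
  using assms
proof (induction bs)
  case Nil
  then show ?case by (simp add: gapfree_def)
next
  case (Cons b bs)
  then show ?case
    using is_block_hd[of q t b] is_block_bounded[of q t b] is_block_gapfree[of q t b]
      gapfree_append[of q b "concat bs"]
    by auto
qed

text \<open>Cut at the first 0. Without a value above \<open>q\<close> as separator, no later value
  can be below \<open>q\<close>.\<close>

lemma gapfree_segment:
  assumes gf: "gapfree q s" and small: "\<forall>x\<in>set s. x \<le> q"
  shows "\<exists>Ms zs n. s = Ms @ zs \<and> set Ms \<subseteq> {1..q} \<and> (zs = [] \<or> zs = 0 # replicate n q)"
proof (cases "0 \<in> set s")
  case False
  then have "set s \<subseteq> {1..q}" using small by (auto simp: Suc_le_eq intro: gr0I)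
  then show ?thesis by (intro exI[of _ s] exI[of _ "[]"]) simp
next
  case True
  then obtain Ms r where s: "s = Ms @ 0 # r" and Ms: "0 \<notin> set Ms"
    by (meson split_list_first)
  have "x = q" if x: "x \<in> set r" for x
  proof (rule ccontr)
    assume "x \<noteq> q"
    then have "x < q" using small s x by (simp add: le_neq_implies_less)
    obtain l where l: "l < length r" "r ! l = x" using x by (auto simp: in_set_conv_nth)
    have gf': "gapfree q (0 # r)" using gf gapfree_appendD2 unfolding s by blast
    have "0 < Suc l" "Suc l < length (0 # r)" "(0 # r) ! 0 = 0" "(0 # r) ! Suc l < q"
      using l \<open>x < q\<close> by simp_all
    from gapfreeD[OF gf' this] obtain m where m: "m < Suc l" "q < (0 # r) ! m" .
    then have "(0 # r) ! m \<in> set (0 # r)" using l by (intro nth_mem) simp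
    then have "(0 # r) ! m \<le> q" using small s by auto
    with m show False by simp
  qed
  then have "r = replicate (length r) q" by (simp add: replicate_eqI)
  moreover have "set Ms \<subseteq> {1..q}" using Ms small s by (auto simp: Suc_le_eq intro: gr0I)
  ultimately show ?thesis
    by (intro exI[of _ Ms] exI[of _ "0 # r"] exI[of _ "length r"]) (simp add: s)
qed

text \<open>Cut before every value above \<open>q\<close>: \<open>s\<close> runs up to the next such
  value, so \<open>B # s\<close> is a block, and \<open>w\<close> is the rest.\<close>

lemma gapfree_imp_concat:
  assumes "gapfree q c" "\<forall>x\<in>set c. x \<le> q + t" "c \<noteq> [] \<longrightarrow> q < hd c"
  shows "\<exists>bs. c = concat bs \<and> (\<forall>b\<in>set bs. is_block q t b)"
  using assms
proof (induction c rule: length_induct)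
  case (1 c)
  show ?case
  proof (cases c)
    case Nil
    then show ?thesis by (intro exI[of _ "[]"]) simp
  next
    case (Cons B rest)
    define s w where "s = takeWhile (\<lambda>x. x \<le> q) rest" and "w = dropWhile (\<lambda>x. x \<le> q) rest"
    have c: "c = (B # s) @ w" by (simp add: Cons s_def w_def)
    have "gapfree q s"
      using "1.prems"(1) gapfree_appendD1[of q s w] gapfree_appendD2[of q "[B]" "s @ w"] c by simp
    moreover have "\<forall>x\<in>set s. x \<le> q" by (auto simp: s_def dest: set_takeWhileD)
    ultimately obtain Ms zs n where "s = Ms @ zs" "set Ms \<subseteq> {1..q}"
      "zs = [] \<or> zs = 0 # replicate n q" using gapfree_segment by blast
    moreover have "B \<in> {1 + q..q + t}" using "1.prems" Cons by simp
    ultimately have block: "is_block q t (B # s)" unfolding is_block_iff by blast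
    have "gapfree q w" using "1.prems"(1) gapfree_appendD2 c by blast
    moreover have "w \<noteq> [] \<longrightarrow> q < hd w"
      using hd_dropWhile[of "\<lambda>x. x \<le> q" rest] unfolding w_def not_le[symmetric] by blast
    moreover have "\<forall>x\<in>set w. x \<le> q + t" "length w < length c" using "1.prems"(2) c by auto
    ultimately obtain bs where "w = concat bs" "\<forall>b\<in>set bs. is_block q t b"
      using "1.IH" by blast
    then show ?thesis using c block by (intro exI[of _ "(B # s) # bs"]) simp
  qed
qed

theorem theorem5:
  fixes q t k :: nat and C :: "nat list"
  assumes "t \<ge> 1" and "k \<ge> 1" and "length C = k"
  shows "critical q t C \<longleftrightarrow> circular_concat_of (is_block q t) C"
proof
  have len: "0 < length C" using assms by simp
  assume "critical q t C"
  then have bounded: "\<forall>x\<in>set C. x \<le> q + t" and nb: "\<And>T. blocked q C T \<Longrightarrow> T = {}"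
    using critical_iff_no_blocked[OF assms(1)] by blast+
  \<comment> \<open>Otherwise the whole rim would block itself.\<close>
  have "\<exists>r<length C. q < C ! r"
  proof (rule ccontr)
    assume "\<not> (\<exists>r<length C. q < C ! r)"
    then have "C ! r \<le> q" if "r < length C" for r using that by force
    then have "blocked q C {..<length C}" by (simp add: blocked_def cpred_less csucc_less)
    from nb[OF this] len show False by auto
  qed
  then obtain r where r: "r < length C" "q < C ! r" by blast
  let ?c = "rotate r C"
  \<comment> \<open>Rotating on by \<open>length C - r\<close> completes a full turn, which carries
    \<open>nb\<close> over to \<open>?c\<close>.\<close>
  have "T = {}" if "blocked q ?c T" for T
  proof (rule no_blocked_rotate[OF _ that])
    fix U assume "blocked q (rotate (length C - r) ?c) U"
    moreover have "rotate (length C - r) ?c = C" using r by (simp add: rotate_rotate)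
    ultimately show "U = {}" using nb by simp
  qed
  then have "gapfree q ?c" by (rule gapfree_if_no_blocked)
  moreover have "q < hd ?c" using r len by (simp add: hd_rotate_conv_nth)
  ultimately obtain bs where "?c = concat bs" "\<forall>b\<in>set bs. is_block q t b"
    using gapfree_imp_concat[of q ?c t] bounded by auto
  then show "circular_concat_of (is_block q t) C" unfolding circular_concat_of_def by blast
next
  assume "circular_concat_of (is_block q t) C"
  then obtain r bs where bs: "rotate r C = concat bs" "\<forall>b\<in>set bs. is_block q t b"
    unfolding circular_concat_of_def by blast
  let ?c = "rotate r C"
  have ne: "?c \<noteq> []" using assms by auto
  have gf: "gapfree q ?c" and bounded: "\<forall>x\<in>set ?c. x \<le> q + t" and "q < hd ?c"
    using concat_blocks[OF bs(2)] ne unfolding bs(1)[symmetric] by blast+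
  then have "q < ?c ! 0" using ne by (simp add: hd_conv_nth)
  then have "T = {}" if "blocked q C T" for T
    using no_blocked_rotate[OF _ that] no_blocked_if_gapfree[OF gf] by blast
  then show "critical q t C" using critical_iff_no_blocked[OF assms(1)] bounded by auto
qed

end
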